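(* Let $R_3(n)$ be the number of partitions of $n$ with max-rook number $3$. As $n\to\infty$, $$R_3(n)\sim \frac{2}{3}n^2,$$ i.e. $\lim_{n\to\infty} R_3(n)/\left(\tfrac23 n^2\right)=1$.
   Context: A partition $\pi$ of a positive integer $n$ is a non-increasing sequence of positive integers $(\lambda_1,\dots,\lambda_r)$ with sum $n$; $\mathscr{P}(n)$ is the set of all partitions of $n$. The Ferrers board $B_\pi$ of $\pi=(\lambda_1,\dots,\lambda_r)$ is the left-justified array of unit squares with $r$ rows whose $i$-th row from the top has $\lambda_i$ squares. Rooks placed on squares of the board are non-intersecting if no two of them lie in the same row or the same column. The max-rook number $R(\pi)$ is the maximal number of non-intersecting rooks that can be placed in $B_\pi$. For positive integers $n,k$, $R_k(n):=\#\{\pi\in\mathscr{P}(n) : R(\pi)=k\}$. *)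

theory Defs
  imports Complex_Main "HOL-Library.Landau_Symbols"
begin

definition partitions :: "nat \<Rightarrow> nat list set" where
  "partitions n = {p. sorted_wrt (\<ge>) p \<and> (\<forall>x\<in>set p. 0 < x) \<and> sum_list p = n}"

(* Squares are pairs (row, column), both counted from 0. *)
definition ferrers_board :: "nat list \<Rightarrow> (nat \<times> nat) set" where
  "ferrers_board p = {(i, j). i < length p \<and> j < p ! i}"

definition non_intersecting :: "(nat \<times> nat) set \<Rightarrow> bool" where
  "non_intersecting S \<longleftrightarrow>
     (\<forall>a\<in>S. \<forall>b\<in>S. a \<noteq> b \<longrightarrow> fst a \<noteq> fst b \<and> snd a \<noteq> snd b)"

definition max_rook :: "nat list \<Rightarrow> nat" where
  "max_rook p = Max {card S | S. S \<subseteq> ferrers_board p \<and> non_intersecting S}"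

definition rook_count :: "nat \<Rightarrow> nat \<Rightarrow> nat" where
  "rook_count k n = card {p \<in> partitions n. max_rook p = k}"

end

theory Submission
  imports Defs "HOL-Real_Asymp.Real_Asymp"
begin

text \<open>
  A set of rooks of size \<open>k\<close> fits on a Ferrers board exactly if the staircase
  \<open>(k, k - 1, \<dots>, 1)\<close> does: the antidiagonal of the staircase carries \<open>k\<close> rooks, and if row \<open>i\<close>
  (counted from 0) is too short for the staircase, then the first \<open>i\<close> rows together with the first
  \<open>k - 1 - i\<close> columns cover the board (\<open>le_max_rook_iff\<close>).  Consequently a partition
  \<open>\<lambda>\<^sub>1 \<ge> \<lambda>\<^sub>2 \<ge> \<dots>\<close> with max-rook number 3 contains \<open>(3, 2, 1)\<close> and satisfies one of
  \<open>\<lambda>\<^sub>4 = 0\<close>, \<open>\<lambda>\<^sub>3 \<le> 1\<close>, \<open>\<lambda>\<^sub>2 \<le> 2\<close>, \<open>\<lambda>\<^sub>1 \<le> 3\<close>.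

  Each of these four families is parametrised by two natural numbers \<open>x, y\<close> with
  \<open>p x + q y \<le> n\<close>, where \<open>(p, q)\<close> is \<open>(2, 3)\<close> for the first and the last family and \<open>(1, 2)\<close> for
  the two others.  Such a triangle contains \<open>n\<^sup>2 / (2 p q) + O(n)\<close> lattice points.  The four
  images of the full triangles cover all partitions of \<open>n\<close> with max-rook number 3; if the
  parameters stay away from the boundary of the triangles, the images are pairwise disjoint and
  consist of such partitions.  The leading coefficient is therefore
  \<open>1/12 + 1/4 + 1/4 + 1/12 = 2/3\<close>.
\<close>

section \<open>The max-rook number and staircases\<close>

lemma finite_ferrers_board: "finite (ferrers_board p)"
proof -
  have "ferrers_board p = Sigma {..<length p} (\<lambda>i. {..<p ! i})"
    by (auto simp: ferrers_board_def)
  then show ?thesis by simp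
qed

lemma finite_rook_placement_sizes:
  "finite {card S | S. S \<subseteq> ferrers_board p \<and> non_intersecting S}"
proof -
  have "{card S | S. S \<subseteq> ferrers_board p \<and> non_intersecting S} \<subseteq> card ` Pow (ferrers_board p)"
    by auto
  then show ?thesis
    by (rule finite_subset) (simp add: finite_ferrers_board)
qed

lemma card_placement_less:
  assumes sorted: "sorted_wrt (\<ge>) p"
    and short: "i < k" "i < length p \<longrightarrow> i + p ! i < k"
    and S: "S \<subseteq> ferrers_board p" "non_intersecting S"
  shows "card S < k"
proof -
  have fin: "finite S"
    using S(1) finite_ferrers_board finite_subset by blast
  let ?top = "{s \<in> S. fst s < i}" and ?low = "{s \<in> S. \<not> fst s < i}"
  have "inj_on fst ?top" "inj_on snd ?low"
    using S(2) unfolding non_intersecting_def inj_on_def by blast+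
  moreover have "fst ` ?top \<subseteq> {..<i}" by auto
  moreover have "snd ` ?low \<subseteq> {..<k - 1 - i}"
  proof
    fix c assume "c \<in> snd ` ?low"
    then obtain r where "(r, c) \<in> S" "i \<le> r" by force
    then have r: "i \<le> r" "r < length p" "c < p ! r"
      using S(1) by (auto simp: ferrers_board_def)
    then have "p ! r \<le> p ! i"
      using sorted by (cases "i = r") (auto simp: sorted_wrt_iff_nth_less)
    then show "c \<in> {..<k - 1 - i}"
      using r short by auto
  qed
  ultimately have "card ?top \<le> i" "card ?low \<le> k - 1 - i"
    using card_inj_on_le [of fst ?top "{..<i}"] card_inj_on_le [of snd ?low "{..<k - 1 - i}"]
    by simp_all
  moreover have "card (?top \<union> ?low) = card ?top + card ?low"
    using fin by (intro card_Un_disjoint) auto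
  moreover have "?top \<union> ?low = S" by blast
  ultimately show ?thesis using short(1) by simp
qed

lemma le_max_rook_iff:
  assumes "sorted_wrt (\<ge>) p"
  shows "k \<le> max_rook p \<longleftrightarrow> (\<forall>i<k. i < length p \<and> k \<le> i + p ! i)"
proof
  assume k: "k \<le> max_rook p"
  have "non_intersecting {}" by (simp add: non_intersecting_def)
  then have "max_rook p \<in> {card S | S. S \<subseteq> ferrers_board p \<and> non_intersecting S}"
    unfolding max_rook_def by (intro Max_in finite_rook_placement_sizes) blast
  then obtain S where S: "S \<subseteq> ferrers_board p" "non_intersecting S" "card S = max_rook p"
    by auto
  show "\<forall>i<k. i < length p \<and> k \<le> i + p ! i"
  proof (rule ccontr)
    assume "\<not> ?thesis"
    then obtain i where "i < k" "i < length p \<longrightarrow> i + p ! i < k"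
      by (auto simp: not_le)
    then have "card S < k"
      using card_placement_less assms S(1,2) by blast
    with k S(3) show False by simp
  qed
next
  assume staircase: "\<forall>i<k. i < length p \<and> k \<le> i + p ! i"
  let ?S = "(\<lambda>i. (i, k - 1 - i)) ` {..<k}"
  have "?S \<subseteq> ferrers_board p"
    using staircase by (fastforce simp: ferrers_board_def)
  moreover have "non_intersecting ?S"
    by (auto simp: non_intersecting_def)
  moreover have "card ?S = k"
    by (subst card_image) (auto simp: inj_on_def)
  ultimately have "k \<in> {card S | S. S \<subseteq> ferrers_board p \<and> non_intersecting S}"
    by (metis (mono_tags, lifting) mem_Collect_eq)
  then show "k \<le> max_rook p"
    unfolding max_rook_def by (intro Max_ge finite_rook_placement_sizes)
qed

lemma max_rook_eq_3_iff:
  assumes "sorted_wrt (\<ge>) p"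
  shows "max_rook p = 3 \<longleftrightarrow>
    3 \<le> length p \<and> 3 \<le> p ! 0 \<and> 2 \<le> p ! 1 \<and> 1 \<le> p ! 2 \<and>
    (length p = 3 \<or> p ! 2 \<le> 1 \<or> p ! 1 \<le> 2 \<or> p ! 0 \<le> 3 \<or> p ! 3 = 0)"
proof -
  have all3: "(\<forall>i<3. P i) \<longleftrightarrow> P 0 \<and> P 1 \<and> P 2"
    and all4: "(\<forall>i<4. P i) \<longleftrightarrow> P 0 \<and> P 1 \<and> P 2 \<and> P 3" for P :: "nat \<Rightarrow> bool"
    by (auto simp: numeral_eq_Suc less_Suc_eq)
  have "max_rook p = 3 \<longleftrightarrow> 3 \<le> max_rook p \<and> \<not> 4 \<le> max_rook p"
    by linarith
  then show ?thesis
    unfolding le_max_rook_iff [OF assms] all3 all4 by auto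
qed

section \<open>Lattice points in a right triangle\<close>

definition triangle :: "nat \<Rightarrow> nat \<Rightarrow> nat \<Rightarrow> (nat \<times> nat) set" where
  "triangle p q n = {(x, y). p * x + q * y \<le> n}"

text \<open>The lattice points whose distance from each side is at least 3, measured in the two
  coordinates and in the slack \<open>n - p x - q y\<close>.\<close>

definition inner_triangle :: "nat \<Rightarrow> nat \<Rightarrow> nat \<Rightarrow> (nat \<times> nat) set" where
  "inner_triangle p q n = {(x, y). 3 \<le> x \<and> 3 \<le> y \<and> p * x + q * y + 3 \<le> n}"

lemma triangle_eq_Sigma:
  assumes "0 < p" "0 < q"
  shows "triangle p q n = Sigma {..n div p} (\<lambda>x. {..(n - p * x) div q})"
proof -
  have "p * x + q * y \<le> n \<longleftrightarrow> x \<le> n div p \<and> y \<le> (n - p * x) div q" for x y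
  proof -
    have "p * x + q * y \<le> n \<longleftrightarrow> p * x \<le> n \<and> q * y \<le> n - p * x" by linarith
    then show ?thesis
      using assms by (simp add: less_eq_div_iff_mult_less_eq mult.commute)
  qed
  then show ?thesis by (auto simp: triangle_def)
qed

lemma finite_triangle: "0 < p \<Longrightarrow> 0 < q \<Longrightarrow> finite (triangle p q n)"
  by (simp add: triangle_eq_Sigma)

lemma sum_decreasing_progression:
  "p * m \<le> n \<Longrightarrow>
    (\<Sum>x\<le>m. real (n - p * x)) = (real m + 1) * (2 * real n - real p * real m) / 2"
proof (induction m)
  case (Suc m)
  have "real (n - p * Suc m) = real n - real p * (real m + 1)"
    by (subst of_nat_diff [OF Suc.prems]) (simp add: algebra_simps)
  moreover have "p * m \<le> n"
    using Suc.prems by simp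
  ultimately show ?case
    using Suc.IH by (simp add: field_simps del: mult_Suc_right)
qed simp

lemma card_triangle_bounds:
  assumes "0 < p" "0 < q"
  shows "real n ^ 2 / (2 * real p * real q) \<le> real (card (triangle p q n))"
    and "real (card (triangle p q n))
          \<le> (real n ^ 2 + real p * real n + real p ^ 2) / (2 * real p * real q) + real n + 1"
proof -
  define m where "m = n div p"
  define r where "r = n mod p"
  have n: "real n = real p * real m + real r"
    unfolding m_def r_def by (metis mult_div_mod_eq of_nat_add of_nat_mult)
  have r: "real r \<le> real p" "0 \<le> real r"
    using assms by (simp_all add: r_def less_imp_le)
  have "card (triangle p q n) = (\<Sum>x\<le>m. (n - p * x) div q + 1)"
    using assms by (simp add: triangle_eq_Sigma m_def)
  then have card: "real (card (triangle p q n)) = (\<Sum>x\<le>m. real ((n - p * x) div q) + 1)"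
    by (simp add: add.commute)
  have div: "real t / real q \<le> real (t div q) + 1" "real (t div q) \<le> real t / real q" for t
  proof -
    have "t < (t div q + 1) * q"
      using assms(2) by (metis add.commute dividend_less_div_times distrib_right mult_1)
    then have "real t < (real (t div q) + 1) * real q"
      by (metis of_nat_1 of_nat_add of_nat_less_iff of_nat_mult)
    then show "real t / real q \<le> real (t div q) + 1"
      using assms by (simp add: field_simps)
  qed (rule of_nat_div_le_of_nat)
  \<comment> \<open>Writing \<open>n = p m + r\<close> turns the arithmetic series into \<open>(n + p - r) (n + r) / (2 p q)\<close>.\<close>
  have "(\<Sum>x\<le>m. real (n - p * x) / real q)
      = (real m + 1) * (2 * real n - real p * real m) / 2 / real q"
    by (subst sum_divide_distrib [symmetric], subst sum_decreasing_progression)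
      (simp_all add: m_def)
  also have "\<dots> = (real n ^ 2 + real p * real n + real r * (real p - real r))
      / (2 * real p * real q)"
    using assms unfolding n by (simp add: field_simps power2_eq_square)
  finally have main: "(\<Sum>x\<le>m. real (n - p * x) / real q)
      = (real n ^ 2 + real p * real n + real r * (real p - real r)) / (2 * real p * real q)" .
  have "real n ^ 2 / (2 * real p * real q) \<le> (\<Sum>x\<le>m. real (n - p * x) / real q)"
    unfolding main using r by (intro divide_right_mono) auto
  also have "\<dots> \<le> real (card (triangle p q n))"
    unfolding card by (intro sum_mono div)
  finally show "real n ^ 2 / (2 * real p * real q) \<le> real (card (triangle p q n))" .
  have "real (card (triangle p q n)) \<le> (\<Sum>x\<le>m. real (n - p * x) / real q + 1)"
    unfolding card by (intro sum_mono add_right_mono div)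
  also have "\<dots> = (\<Sum>x\<le>m. real (n - p * x) / real q) + real m + 1"
    by (simp add: sum.distrib)
  finally have upper: "real (card (triangle p q n))
      \<le> (\<Sum>x\<le>m. real (n - p * x) / real q) + real m + 1" .
  have "real r * (real p - real r) \<le> real p * real p"
    using r by (intro mult_mono) auto
  then have "(\<Sum>x\<le>m. real (n - p * x) / real q)
      \<le> (real n ^ 2 + real p * real n + real p ^ 2) / (2 * real p * real q)"
    unfolding main by (intro divide_right_mono) (auto simp: power2_eq_square)
  moreover have "real m \<le> real n"
    by (simp add: m_def)
  ultimately show "real (card (triangle p q n))
      \<le> (real n ^ 2 + real p * real n + real p ^ 2) / (2 * real p * real q) + real n + 1"
    using upper by linarith
qed

lemma card_inner_triangle_ge:
  assumes "0 < p" "0 < q" "3 * p + 3 * q + 3 \<le> s" "s \<le> n"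
  shows "(real n - real s) ^ 2 / (2 * real p * real q) \<le> real (card (inner_triangle p q n))"
proof -
  let ?shift = "\<lambda>(x, y). (x + 3, y + 3) :: nat \<times> nat"
  have "inner_triangle p q n \<subseteq> triangle p q n"
    by (auto simp: inner_triangle_def triangle_def)
  then have "finite (inner_triangle p q n)"
    using assms finite_triangle finite_subset by blast
  moreover have "?shift ` triangle p q (n - s) \<subseteq> inner_triangle p q n"
    using assms by (auto simp: inner_triangle_def triangle_def algebra_simps)
  moreover have "inj_on ?shift (triangle p q (n - s))"
    by (auto simp: inj_on_def)
  ultimately have "card (triangle p q (n - s)) \<le> card (inner_triangle p q n)"
    by (metis card_inj_on_le)
  then show ?thesis
    using card_triangle_bounds(1) [of p q "n - s"] assms by (simp add: of_nat_diff)
qed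

section \<open>Four two-parameter families of partitions\<close>

text \<open>Partitions of \<open>n\<close> into three parts (if \<open>y > 0\<close>), with \<open>x\<close> columns of length 2 and \<open>y\<close> of length 3.  Here
  the slack \<open>n - 2 x - 3 y\<close> is the number of columns of length 1; in the other families the slack
  is the number of parts equal to 1.  In all cases the entries sum to \<open>n\<close> as long as \<open>(x, y)\<close>
  lies in the corresponding triangle; outside it the subtractions are truncated.\<close>

definition three_rows :: "nat \<Rightarrow> nat \<times> nat \<Rightarrow> nat list" where
  "three_rows n = (\<lambda>(x, y). [n - x - 2 * y, x + y, y])"

text \<open>Two arbitrary parts \<open>x + y \<ge> y\<close>, all others equal to 1.\<close>

definition two_rows_one_column :: "nat \<Rightarrow> nat \<times> nat \<Rightarrow> nat list" where
  "two_rows_one_column n = (\<lambda>(x, y). [x + y, y] @ replicate (n - x - 2 * y) 1)"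

text \<open>One arbitrary part \<open>x\<close>, then \<open>y\<close> parts equal to 2, all others equal to 1.\<close>

definition one_row_two_columns :: "nat \<Rightarrow> nat \<times> nat \<Rightarrow> nat list" where
  "one_row_two_columns n = (\<lambda>(x, y). [x] @ replicate y 2 @ replicate (n - x - 2 * y) 1)"

text \<open>All parts at most 3.\<close>

definition three_columns :: "nat \<Rightarrow> nat \<times> nat \<Rightarrow> nat list" where
  "three_columns n =
    (\<lambda>(x, y). replicate y 3 @ replicate x 2 @ replicate (n - 2 * x - 3 * y) 1)"

lemmas family_defs =
  three_rows_def two_rows_one_column_def one_row_two_columns_def three_columns_def

lemma inj_on_families:
  "inj_on (three_rows n) A" "inj_on (two_rows_one_column n) A"
  "inj_on (one_row_two_columns n) A" "inj_on (three_columns n) A"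
proof -
  show "inj_on (three_rows n) A" "inj_on (two_rows_one_column n) A"
    by (auto simp: inj_on_def family_defs)
  show "inj_on (one_row_two_columns n) A"
  proof (rule inj_onI, clarify)
    fix x y x' y'
    assume eq: "one_row_two_columns n (x, y) = one_row_two_columns n (x', y')"
    then have x: "x = x'" by (simp add: family_defs)
    with arg_cong [OF eq, of "\<lambda>p. length (filter ((=) 2) p)"] show "x = x' \<and> y = y'"
      by (simp add: family_defs split: if_splits)
  qed
  show "inj_on (three_columns n) A"
  proof (rule inj_onI, clarify)
    fix x y x' y'
    assume eq: "three_columns n (x, y) = three_columns n (x', y')"
    from arg_cong [OF eq, of "\<lambda>p. length (filter ((=) 2) p)"]
      arg_cong [OF eq, of "\<lambda>p. length (filter ((=) 3) p)"]
    show "x = x' \<and> y = y'"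
      by (simp add: family_defs)
  qed
qed

subsection \<open>Every partition with max-rook number 3 lies in one of the families\<close>

lemma split_off_largest_part:
  assumes "sorted_wrt (\<ge>) p" "\<forall>x\<in>set p. x \<le> Suc m"
  shows "\<exists>k q. p = replicate k (Suc m) @ q \<and> sorted_wrt (\<ge>) q \<and> (\<forall>x\<in>set q. x \<le> m)"
  using assms
proof (induction p)
  case (Cons a p)
  show ?case
  proof (cases "a = Suc m")
    case True
    from Cons obtain k q where
      "p = replicate k (Suc m) @ q" "sorted_wrt (\<ge>) q" "\<forall>x\<in>set q. x \<le> m"
      by auto
    with True show ?thesis
      by (intro exI [of _ "Suc k"] exI [of _ q]) auto
  next
    case False
    with Cons.prems have "\<forall>x\<in>set (a # p). x \<le> m" by force
    with Cons.prems(1) show ?thesis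
      by (intro exI [of _ 0] exI [of _ "a # p"]) auto
  qed
qed auto

lemma all_ones:
  assumes "\<forall>x\<in>set p. 0 < x \<and> x \<le> (1 :: nat)"
  shows "p = replicate (length p) 1"
  using assms by (intro replicate_eqI) (auto simp: le_Suc_eq)

lemma parts_le_2:
  assumes "sorted_wrt (\<ge>) p" "\<forall>x\<in>set p. 0 < x \<and> x \<le> (2 :: nat)"
  obtains i j where "p = replicate i 2 @ replicate j 1"
proof -
  obtain i q where q: "p = replicate i (Suc 1) @ q" "\<forall>x\<in>set q. x \<le> 1"
    using split_off_largest_part [of p 1] assms by (auto simp: numeral_2_eq_2)
  have "\<forall>x\<in>set q. 0 < x \<and> x \<le> 1"
    using q(2) assms(2) unfolding q(1) set_append by blast
  then have "q = replicate (length q) 1"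
    by (rule all_ones)
  with q(1) show thesis
    by (metis that Suc_1)
qed

lemma parts_le_3:
  assumes "sorted_wrt (\<ge>) p" "\<forall>x\<in>set p. 0 < x \<and> x \<le> (3 :: nat)"
  obtains h i j where "p = replicate h 3 @ replicate i 2 @ replicate j 1"
proof -
  obtain h q where q: "p = replicate h (Suc 2) @ q" "sorted_wrt (\<ge>) q" "\<forall>x\<in>set q. x \<le> 2"
    using split_off_largest_part [of p 2] assms by (auto simp: numeral_eq_Suc)
  have "\<forall>x\<in>set q. 0 < x \<and> x \<le> 2"
    using q(3) assms(2) unfolding q(1) set_append by blast
  with q(2) obtain i j where "q = replicate i 2 @ replicate j 1"
    by (rule parts_le_2)
  with q(1) show thesis
    using that [of h i j] by (simp add: numeral_3_eq_3)
qed

lemma max_rook_3_subset_families: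
  "{p \<in> partitions n. max_rook p = 3} \<subseteq>
    (three_rows n ` triangle 2 3 n \<union> two_rows_one_column n ` triangle 1 2 n) \<union>
    (one_row_two_columns n ` triangle 1 2 n \<union> three_columns n ` triangle 2 3 n)"
proof (rule subsetI, elim CollectE conjE)
  fix p assume p: "p \<in> partitions n" "max_rook p = 3"
  then have sorted: "sorted_wrt (\<ge>) p" and pos: "\<forall>x\<in>set p. 0 < x" and sum: "sum_list p = n"
    by (auto simp: partitions_def)
  have shape: "3 \<le> length p"
    "length p = 3 \<or> p ! 2 \<le> 1 \<or> p ! 1 \<le> 2 \<or> p ! 0 \<le> 3 \<or> p ! 3 = 0"
    using p(2) unfolding max_rook_eq_3_iff [OF sorted] by auto
  obtain a b c q where abc: "p = a # b # c # q"
    using shape(1) by (auto simp: numeral_3_eq_3 Suc_le_length_iff)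
  have ge: "b \<le> a" "c \<le> b" "\<forall>x\<in>set q. x \<le> c" "sorted_wrt (\<ge>) q"
    using sorted abc by auto
  consider "q = []" | "c \<le> 1" | "b \<le> 2" | "a \<le> 3"
    using shape(2) pos by (cases q) (auto simp: abc)
  then show "p \<in> (three_rows n ` triangle 2 3 n \<union> two_rows_one_column n ` triangle 1 2 n) \<union>
    (one_row_two_columns n ` triangle 1 2 n \<union> three_columns n ` triangle 2 3 n)"
  proof cases
    case 1
    then have "p = three_rows n (b - c, c)" "(b - c, c) \<in> triangle 2 3 n"
      using abc ge sum by (auto simp: family_defs triangle_def)
    then show ?thesis by blast
  next
    case 2
    have "c # q = replicate (length (c # q)) 1"
      using 2 ge pos abc by (intro all_ones) force
    then obtain j where j: "c # q = replicate j 1" ..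
    then have "sum_list (c # q) = j" by (simp add: sum_list_replicate)
    then have "p = two_rows_one_column n (a - b, b)" "(a - b, b) \<in> triangle 1 2 n"
      using abc ge sum j by (auto simp: family_defs triangle_def)
    then show ?thesis by blast
  next
    case 3
    have "sorted_wrt (\<ge>) (b # c # q)" "\<forall>x\<in>set (b # c # q). 0 < x \<and> x \<le> 2"
      using 3 ge pos sorted unfolding abc by force+
    then obtain i j where ij: "b # c # q = replicate i 2 @ replicate j 1"
      by (rule parts_le_2)
    then have "sum_list (b # c # q) = 2 * i + j" by (simp add: sum_list_replicate)
    then have "p = one_row_two_columns n (a, i)" "(a, i) \<in> triangle 1 2 n"
      using abc sum ij by (auto simp: family_defs triangle_def)
    then show ?thesis by blast
  next
    case 4
    have "\<forall>x\<in>set p. 0 < x \<and> x \<le> 3"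
      using 4 ge pos unfolding abc by force
    with sorted obtain h i j where hij: "p = replicate h 3 @ replicate i 2 @ replicate j 1"
      by (rule parts_le_3)
    then have "sum_list p = 3 * h + 2 * i + j" by (simp add: sum_list_replicate)
    then have "p = three_columns n (i, h)" "(i, h) \<in> triangle 2 3 n"
      using sum hij by (auto simp: family_defs triangle_def)
    then show ?thesis by blast
  qed
qed

subsection \<open>Inner parameters give distinct partitions with max-rook number 3\<close>

lemma sorted_wrt_replicate: "sorted_wrt (\<ge>) (replicate k (a :: nat))"
  by (induction k) auto

text \<open>Besides membership, each statement records the length and the entries that separate the
  family from the others.\<close>

lemma three_rows_inner:
  assumes "(x, y) \<in> inner_triangle 2 3 n"
  shows "three_rows n (x, y) \<in> {p \<in> partitions n. max_rook p = 3 \<and> length p = 3}"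
proof -
  let ?p = "three_rows n (x, y)"
  have "?p \<in> partitions n"
    using assms by (auto simp: partitions_def family_defs inner_triangle_def)
  moreover from this have "max_rook ?p = 3"
    using assms
    by (subst max_rook_eq_3_iff) (auto simp: partitions_def family_defs inner_triangle_def)
  ultimately show ?thesis by (simp add: family_defs)
qed

lemma two_rows_one_column_inner:
  assumes "(x, y) \<in> inner_triangle 1 2 n"
  shows "two_rows_one_column n (x, y) \<in>
    {p \<in> partitions n. max_rook p = 3 \<and> length p \<noteq> 3 \<and> p ! 2 = 1}"
proof -
  let ?p = "two_rows_one_column n (x, y)"
  have "?p \<in> partitions n"
    using assms
    by (auto simp: partitions_def family_defs inner_triangle_def sum_list_replicate
        sorted_wrt_append sorted_wrt_replicate)
  moreover from this have "max_rook ?p = 3"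
    using assms
    by (subst max_rook_eq_3_iff) (auto simp: partitions_def family_defs inner_triangle_def)
  ultimately show ?thesis
    using assms by (auto simp: family_defs inner_triangle_def)
qed

lemma one_row_two_columns_inner:
  assumes "(x, y) \<in> inner_triangle 1 2 n"
  shows "one_row_two_columns n (x, y) \<in>
    {p \<in> partitions n. max_rook p = 3 \<and> length p \<noteq> 3 \<and> p ! 2 \<noteq> 1 \<and> p ! 1 = 2}"
proof -
  let ?p = "one_row_two_columns n (x, y)"
  have "?p \<in> partitions n"
    using assms
    by (auto simp: partitions_def family_defs inner_triangle_def sum_list_replicate
        sorted_wrt_append sorted_wrt_replicate)
  moreover have parts: "?p ! 0 = x" "?p ! 1 = 2" "?p ! 2 = 2" "3 < length ?p"
    using assms by (auto simp: family_defs inner_triangle_def nth_append)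
  moreover have "sorted_wrt (\<ge>) ?p"
    using calculation(1) by (simp add: partitions_def)
  then have "max_rook ?p = 3"
    using assms parts by (simp add: max_rook_eq_3_iff inner_triangle_def)
  ultimately show ?thesis by simp
qed

lemma three_columns_inner:
  assumes "(x, y) \<in> inner_triangle 2 3 n"
  shows "three_columns n (x, y) \<in>
    {p \<in> partitions n. max_rook p = 3 \<and> length p \<noteq> 3 \<and> p ! 2 \<noteq> 1 \<and> p ! 1 \<noteq> 2}"
proof -
  let ?p = "three_columns n (x, y)"
  have "?p \<in> partitions n"
    using assms
    by (auto simp: partitions_def family_defs inner_triangle_def sum_list_replicate
        sorted_wrt_append sorted_wrt_replicate)
  moreover have parts: "?p ! 0 = 3" "?p ! 1 = 3" "?p ! 2 = 3" "3 < length ?p"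
    using assms by (auto simp: family_defs inner_triangle_def nth_append)
  moreover have "sorted_wrt (\<ge>) ?p"
    using calculation(1) by (simp add: partitions_def)
  then have "max_rook ?p = 3"
    using assms parts by (simp add: max_rook_eq_3_iff inner_triangle_def)
  ultimately show ?thesis by simp
qed

section \<open>Bounds for the number of partitions with max-rook number 3\<close>

lemma finite_max_rook_3: "finite {p \<in> partitions n. max_rook p = 3}"
  by (rule finite_subset [OF max_rook_3_subset_families]) (simp add: finite_triangle)

lemma rook_count_3_le:
  "rook_count 3 n \<le> 2 * card (triangle 2 3 n) + 2 * card (triangle 1 2 n)"
proof -
  let ?A = "three_rows n ` triangle 2 3 n" and ?B = "two_rows_one_column n ` triangle 1 2 n"
    and ?C = "one_row_two_columns n ` triangle 1 2 n" and ?D = "three_columns n ` triangle 2 3 n"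
  have "rook_count 3 n \<le> card ((?A \<union> ?B) \<union> (?C \<union> ?D))"
    unfolding rook_count_def
    by (intro card_mono max_rook_3_subset_families) (simp add: finite_triangle)
  also have "\<dots> \<le> (card ?A + card ?B) + (card ?C + card ?D)"
    by (meson add_mono card_Un_le order_trans)
  also have "\<dots> = 2 * card (triangle 2 3 n) + 2 * card (triangle 1 2 n)"
    by (simp add: card_image inj_on_families)
  finally show ?thesis .
qed

lemma rook_count_3_ge:
  "2 * card (inner_triangle 2 3 n) + 2 * card (inner_triangle 1 2 n) \<le> rook_count 3 n"
proof -
  let ?A = "three_rows n ` inner_triangle 2 3 n"
    and ?B = "two_rows_one_column n ` inner_triangle 1 2 n"
    and ?C = "one_row_two_columns n ` inner_triangle 1 2 n"
    and ?D = "three_columns n ` inner_triangle 2 3 n"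
  let ?R = "{p \<in> partitions n. max_rook p = 3}"
  have A: "?A \<subseteq> {p \<in> ?R. length p = 3}"
    by (auto dest: three_rows_inner)
  have B: "?B \<subseteq> {p \<in> ?R. length p \<noteq> 3 \<and> p ! 2 = 1}"
    by (auto dest: two_rows_one_column_inner simp del: One_nat_def)
  have C: "?C \<subseteq> {p \<in> ?R. length p \<noteq> 3 \<and> p ! 2 \<noteq> 1 \<and> p ! 1 = 2}"
    by (auto dest: one_row_two_columns_inner simp del: One_nat_def)
  have D: "?D \<subseteq> {p \<in> ?R. length p \<noteq> 3 \<and> p ! 2 \<noteq> 1 \<and> p ! 1 \<noteq> 2}"
    by (auto dest: three_columns_inner simp del: One_nat_def)
  have sub: "?A \<union> ?B \<union> ?C \<union> ?D \<subseteq> ?R"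
    using A B C D by blast
  have "finite (?A \<union> ?B \<union> ?C \<union> ?D)"
    by (rule finite_subset [OF sub finite_max_rook_3])
  then have fin: "finite ?A" "finite ?B" "finite ?C" "finite ?D"
    by (simp_all only: finite_Un)
  have disj: "?A \<inter> ?B = {}" "(?A \<union> ?B) \<inter> ?C = {}" "(?A \<union> ?B \<union> ?C) \<inter> ?D = {}"
    using A B C D by blast+
  have "2 * card (inner_triangle 2 3 n) + 2 * card (inner_triangle 1 2 n)
      = card ?A + card ?B + card ?C + card ?D"
    by (simp add: card_image inj_on_families)
  also have "\<dots> = card (?A \<union> ?B \<union> ?C \<union> ?D)"
    using fin disj by (simp add: card_Un_disjoint)
  also have "\<dots> \<le> rook_count 3 n"
    unfolding rook_count_def by (intro card_mono finite_max_rook_3 sub)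
  finally show ?thesis .
qed

theorem corollary4p2:
  "(\<lambda>n::nat. real (rook_count 3 n)) \<sim>[at_top] (\<lambda>n. 2 / 3 * real n ^ 2)"
proof (rule asymp_equiv_sandwich_real)
  \<comment> \<open>18 is the value of \<open>3 p + 3 q + 3\<close> for \<open>(p, q) = (2, 3)\<close>, the larger of the two shifts.\<close>
  let ?lower = "\<lambda>n::nat. 2 / 3 * (real n - 18) ^ 2"
  let ?upper = "\<lambda>n::nat. 2 / 3 * real n ^ 2 + 5 * real n + 6"
  show "?lower \<sim>[at_top] (\<lambda>n. 2 / 3 * real n ^ 2)"
    by real_asymp
  show "?upper \<sim>[at_top] (\<lambda>n. 2 / 3 * real n ^ 2)"
    by real_asymp
  have "?lower n \<le> real (rook_count 3 n)" if "18 \<le> n" for n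
    using card_inner_triangle_ge [of 2 3 18 n] card_inner_triangle_ge [of 1 2 18 n] that
      of_nat_mono [OF rook_count_3_ge [of n], where 'a = real]
    by simp
  moreover have "real (rook_count 3 n) \<le> ?upper n" for n
    using card_triangle_bounds(2) [of 2 3 n] card_triangle_bounds(2) [of 1 2 n]
      of_nat_mono [OF rook_count_3_le [of n], where 'a = real]
    by (simp add: add_divide_distrib)
  ultimately show "\<forall>\<^sub>F n in at_top. real (rook_count 3 n) \<in> {?lower n..?upper n}"
    by (auto intro: eventually_mono [OF eventually_ge_at_top [of 18]])
qed

end
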